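(* For every $\varepsilon>0$ there is $n_0$ such that for every $n\ge n_0$ there exists an $n$-component increasing network $f$ with \[ \lambda(f)\ \ge\ \left(\frac1e-\varepsilon\right)n^2 . \]
   Context: An $n$-component (Boolean) network is a function $f=(f_1,\dots,f_n):\{0,1\}^n\to\{0,1\}^n$. Write $[n]=\{1,\dots,n\}$. For $i\in[n]$ and $x\in\{0,1\}^n$, $f^i(x):=(x_1,\dots,x_{i-1},f_i(x),x_{i+1},\dots,x_n)$. For a word $w=i_1i_2\dots i_k$ over the alphabet $[n]$, $f^w:=f^{i_k}\circ\cdots\circ f^{i_1}$ (and $f^\epsilon=\mathrm{id}$ for the empty word). A word $w$ fixes $f$ if $f^w(x)$ is a fixed point of $f$ for every $x\in\{0,1\}^n$; the fixing length $\lambda(f)$ is the minimum length of a word fixing $f$. The network $f$ is increasing if $x\le f(x)$ (componentwise) for all $x\in\{0,1\}^n$. (Increasing networks always admit a fixing word.) Here $e$ is Euler's number. *)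

theory Defs
  imports Complex_Main "HOL-Library.FuncSet"
begin

text \<open>
  The cube \<open>{0,1}\<^sup>n\<close>, with coordinates indexed by \<open>{1..n}\<close>. Configurations are extensional
  functions (they take the value \<^const>\<open>undefined\<close> outside \<open>{1..n}\<close>), so HOL equality of
  configurations is equality of \<open>n\<close>-tuples. The order on \<^typ>\<open>bool\<close> is \<open>False \<le> True\<close>.
\<close>

definition cube :: "nat \<Rightarrow> (nat \<Rightarrow> bool) set" where
  "cube n = ({1..n} \<rightarrow>\<^sub>E (UNIV :: bool set))"

definition network :: "nat \<Rightarrow> ((nat \<Rightarrow> bool) \<Rightarrow> (nat \<Rightarrow> bool)) \<Rightarrow> bool" where
  "network n f \<longleftrightarrow> f \<in> cube n \<rightarrow> cube n"

definition increasing :: "nat \<Rightarrow> ((nat \<Rightarrow> bool) \<Rightarrow> (nat \<Rightarrow> bool)) \<Rightarrow> bool" where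
  "increasing n f \<longleftrightarrow> (\<forall>x\<in>cube n. \<forall>i\<in>{1..n}. x i \<le> f x i)"

definition update :: "((nat \<Rightarrow> bool) \<Rightarrow> (nat \<Rightarrow> bool)) \<Rightarrow> nat \<Rightarrow> (nat \<Rightarrow> bool) \<Rightarrow> (nat \<Rightarrow> bool)" where
  "update f i x = x(i := f x i)"

text \<open>The leftmost letter of the word is applied first.\<close>

definition update_word ::
    "((nat \<Rightarrow> bool) \<Rightarrow> (nat \<Rightarrow> bool)) \<Rightarrow> nat list \<Rightarrow> (nat \<Rightarrow> bool) \<Rightarrow> (nat \<Rightarrow> bool)" where
  "update_word f w = fold (update f) w"

definition fixing_word :: "nat \<Rightarrow> ((nat \<Rightarrow> bool) \<Rightarrow> (nat \<Rightarrow> bool)) \<Rightarrow> nat list \<Rightarrow> bool" where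
  "fixing_word n f w \<longleftrightarrow>
     set w \<subseteq> {1..n} \<and> (\<forall>x\<in>cube n. f (update_word f w x) = update_word f w x)"

text \<open>
  Only meaningful if some word fixes \<open>f\<close>; for increasing networks this is
  \<open>increasing_fixing_word_exists\<close> below.
\<close>

definition fixing_length :: "nat \<Rightarrow> ((nat \<Rightarrow> bool) \<Rightarrow> (nat \<Rightarrow> bool)) \<Rightarrow> nat" where
  "fixing_length n f = (LEAST k. \<exists>w. fixing_word n f w \<and> length w = k)"

lemma finite_cube: "finite (cube n)"
  unfolding cube_def by (intro finite_PiE) auto

lemma update_in_cube: "x \<in> cube n \<Longrightarrow> i \<in> {1..n} \<Longrightarrow> update f i x \<in> cube n"
  by (auto simp: cube_def update_def PiE_iff extensional_def)

lemma update_word_in_cube: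
  "x \<in> cube n \<Longrightarrow> set w \<subseteq> {1..n} \<Longrightarrow> update_word f w x \<in> cube n"
  unfolding update_word_def
  by (induction w arbitrary: x) (simp_all add: update_in_cube del: atLeastAtMost_iff)

lemma update_word_fixed: "f x = x \<Longrightarrow> update_word f w x = x"
  unfolding update_word_def by (induction w) (simp_all add: update_def)

lemma update_word_append: "update_word f (v @ w) x = update_word f w (update_word f v x)"
  by (simp add: update_word_def)

lemma increasing_fixing_word_point:
  assumes "network n f" "increasing n f" "x \<in> cube n"
  shows "\<exists>w. set w \<subseteq> {1..n} \<and> f (update_word f w x) = update_word f w x"
  using assms(3)
proof (induction "card {i\<in>{1..n}. \<not> x i}" arbitrary: x rule: less_induct)
  case less
  show ?case
  proof (cases "f x = x")
    case True
    then show ?thesis by (intro exI[of _ "[]"]) (simp add: update_word_def)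
  next
    case False
    have "f x \<in> cube n" using assms(1) less.prems by (auto simp: network_def)
    with False less.prems have "\<exists>i\<in>{1..n}. f x i \<noteq> x i"
      unfolding cube_def by (blast intro: PiE_ext)
    then obtain i where i: "i \<in> {1..n}" "f x i \<noteq> x i" by blast
    with assms(2) less.prems have xi: "\<not> x i" "f x i"
      by (auto simp: increasing_def)
    have "{j\<in>{1..n}. \<not> update f i x j} \<subset> {j\<in>{1..n}. \<not> x j}"
      using i(1) xi by (auto simp: update_def)
    then have "card {j\<in>{1..n}. \<not> update f i x j} < card {j\<in>{1..n}. \<not> x j}"
      by (intro psubset_card_mono) auto
    from less.hyps[OF this update_in_cube[OF less.prems i(1)]]
    obtain w where "set w \<subseteq> {1..n}"
      "f (update_word f w (update f i x)) = update_word f w (update f i x)" by blast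
    then show ?thesis using i(1)
      by (intro exI[of _ "i # w"]) (simp add: update_word_def)
  qed
qed

lemma increasing_fixing_word_exists:
  assumes "network n f" "increasing n f"
  shows "\<exists>w. fixing_word n f w"
proof -
  have "\<exists>w. set w \<subseteq> {1..n} \<and> (\<forall>x\<in>S. f (update_word f w x) = update_word f w x)"
    if "finite S" "S \<subseteq> cube n" for S
    using that
  proof (induction S rule: finite_induct)
    case empty
    show ?case by (intro exI[of _ "[]"]) simp
  next
    case (insert x S)
    then obtain w where w: "set w \<subseteq> {1..n}"
      "\<forall>x\<in>S. f (update_word f w x) = update_word f w x" by auto
    from insert.prems w(1) have "update_word f w x \<in> cube n"
      by (intro update_word_in_cube) auto
    from increasing_fixing_word_point[OF assms this] obtain v where v: "set v \<subseteq> {1..n}"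
      "f (update_word f v (update_word f w x)) = update_word f v (update_word f w x)" by blast
    show ?case using w v
      by (intro exI[of _ "w @ v"]) (auto simp: update_word_append update_word_fixed)
  qed
  from this[OF finite_cube subset_refl] show ?thesis by (auto simp: fixing_word_def)
qed

end

theory Submission
  imports Defs "HOL-Combinatorics.Multiset_Permutations" "HOL-Library.Sublist" "HOL-Real_Asymp.Real_Asymp"
begin

text \<open>
  About \<open>2 log\<^sub>2 n\<close> coordinates are frozen and used as an index into a family of at least
  \<open>n\<^sup>2\<close> permutations of the other \<open>N\<close> coordinates; the network raises these one by
  one in the order given by the selected permutation. A fixing word must then contain every
  permutation of the family as a subsequence. A word of length at most \<open>c n\<^sup>2\<close> contains at
  most \<open>(c n\<^sup>2 / N)\<^sup>N\<close> permutations: choose one occurrence of each letter and apply AM-GM.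
  As \<open>N! \<ge> (N / e)\<^sup>N\<close>, for \<open>c < 1 / e\<close> this is an exponentially small fraction of all
  permutations, and a union bound over words produces a family that no such word contains.
\<close>

section \<open>Counting the permutations contained in a word\<close>

definition contained_perms :: "'a set \<Rightarrow> 'a list \<Rightarrow> 'a list set" where
  "contained_perms A w = {p \<in> permutations_of_set A. subseq p w}"

lemma finite_contained_perms [simp]: "finite (contained_perms A w)"
  by (simp add: contained_perms_def)

text \<open>Induction on the word. A permutation contained in \<open>x # w\<close> either is
  contained in \<open>w\<close> or starts with \<open>x\<close> and has its tail contained in
  \<open>w\<close>. The product obeys the matching recurrence: raising the count of \<open>x\<close>
  by one adds the product over \<open>A - {x}\<close>.\<close>

lemma card_contained_perms_le_prod:
  assumes "finite A"
  shows "card (contained_perms A w) \<le> (\<Prod>a\<in>A. count_list w a)"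
  using assms
proof (induction w arbitrary: A)
  case Nil
  show ?case
  proof (cases "A = {}")
    case False
    then have "contained_perms A [] = {}"
      by (auto simp: contained_perms_def permutations_of_set_def)
    then show ?thesis by simp
  next
    case True
    then have "contained_perms A [] = {[]}" by (auto simp: contained_perms_def)
    with True show ?thesis by simp
  qed
next
  case (Cons x w)
  show ?case
  proof (cases "x \<in> A")
    case True
    have "contained_perms A (x # w)
        \<subseteq> contained_perms A w \<union> (#) x ` contained_perms (A - {x}) w"
    proof
      fix p assume p: "p \<in> contained_perms A (x # w)"
      show "p \<in> contained_perms A w \<union> (#) x ` contained_perms (A - {x}) w"
        using p by (cases p) (auto simp: contained_perms_def permutations_of_set_def split: if_splits)
    qed
    then have "card (contained_perms A (x # w))
        \<le> card (contained_perms A w \<union> (#) x ` contained_perms (A - {x}) w)"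
      by (intro card_mono) auto
    also have "\<dots> \<le> card (contained_perms A w) + card (contained_perms (A - {x}) w)"
      by (intro order.trans[OF card_Un_le] add_mono card_image_le) auto
    also have "\<dots> \<le> (\<Prod>a\<in>A. count_list w a) + (\<Prod>a\<in>A - {x}. count_list w a)"
      using Cons.prems by (intro add_mono Cons.IH) auto
    also have "\<dots> = Suc (count_list w x) * (\<Prod>a\<in>A - {x}. count_list w a)"
      using True Cons.prems by (simp add: prod.remove)
    also have "(\<Prod>a\<in>A - {x}. count_list w a) = (\<Prod>a\<in>A - {x}. count_list (x # w) a)"
      by (intro prod.cong) auto
    also have "Suc (count_list w x) * \<dots> = (\<Prod>a\<in>A. count_list (x # w) a)"
      using True Cons.prems by (simp add: prod.remove[of A x])
    finally show ?thesis .
  next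
    case False
    have "contained_perms A (x # w) \<subseteq> contained_perms A w"
    proof
      fix p assume p: "p \<in> contained_perms A (x # w)"
      show "p \<in> contained_perms A w"
        using p False by (cases p) (auto simp: contained_perms_def permutations_of_set_def split: if_splits)
    qed
    then have "card (contained_perms A (x # w)) \<le> card (contained_perms A w)"
      by (intro card_mono) auto
    also have "\<dots> \<le> (\<Prod>a\<in>A. count_list w a)"
      using Cons.prems by (rule Cons.IH)
    also have "\<dots> = (\<Prod>a\<in>A. count_list (x # w) a)"
      using False by (intro prod.cong) auto
    finally show ?thesis .
  qed
qed

lemma sum_count_list_le_length:
  assumes "finite A"
  shows "(\<Sum>a\<in>A. count_list w a) \<le> length w"
proof -
  have "(\<Sum>a\<in>A. count_list w a) \<le> (\<Sum>a\<in>A \<union> set w. count_list w a)"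
    using assms by (intro sum_mono2) auto
  also have "\<dots> = (\<Sum>a\<in>set w. count_list w a)"
    using assms by (intro sum.mono_neutral_right) auto
  also have "\<dots> = length w" by (rule sum_count_set) auto
  finally show ?thesis .
qed

text \<open>AM-GM applied to the product of the letter counts, whose average over \<open>A\<close>
  is at most \<open>t\<close>.\<close>

lemma card_contained_perms_le_power:
  fixes t :: real
  assumes "finite A" "t > 0" "real (length w) \<le> t * real (card A)"
  shows "real (card (contained_perms A w)) \<le> t ^ card A"
proof -
  \<comment> \<open>This is \<open>1 + y \<le> exp y\<close> at \<open>y = k / t - 1\<close>, tight
    at \<open>k = t\<close>. Multiplied over all letters, the exponents add up to at most 0, which
    yields AM-GM without any roots.\<close>
  have step: "real k \<le> t * exp (real k / t - 1)" for k
  proof -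
    have "real k / t \<le> exp (real k / t - 1)"
      using exp_ge_add_one_self[of "real k / t - 1"] by simp
    then show ?thesis using assms(2) by (simp add: field_simps)
  qed
  have "(\<Sum>a\<in>A. real (count_list w a)) \<le> real (length w)"
    using sum_count_list_le_length[OF assms(1), of w] by (simp flip: of_nat_sum)
  also note assms(3)
  finally have sum: "(\<Sum>a\<in>A. real (count_list w a)) / t \<le> real (card A)"
    using assms(2) by (simp add: field_simps)
  have "real (card (contained_perms A w)) \<le> (\<Prod>a\<in>A. real (count_list w a))"
    using card_contained_perms_le_prod[OF assms(1), of w] by (simp flip: of_nat_prod)
  also have "\<dots> \<le> (\<Prod>a\<in>A. t * exp (real (count_list w a) / t - 1))"
    by (intro prod_mono) (simp add: step)
  also have "\<dots> = t ^ card A * exp ((\<Sum>a\<in>A. real (count_list w a)) / t - real (card A))"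
    using assms(1) by (simp add: prod.distrib sum_subtractf sum_divide_distrib flip: exp_sum)
  also have "\<dots> \<le> t ^ card A * 1"
    using sum assms(2) by (intro mult_left_mono) auto
  finally show ?thesis by simp
qed

text \<open>The left side divided by \<open>fact n\<close> is a single term of the exponential
  series of \<open>exp n\<close>, all of whose terms are nonnegative.\<close>

lemma power_le_exp_mult_fact: "real n ^ n \<le> exp (real n) * fact n"
proof -
  have "(\<Sum>k\<in>{n}. real n ^ k /\<^sub>R fact k) \<le> (\<Sum>k. real n ^ k /\<^sub>R fact k)"
    by (intro sum_le_suminf summable_exp_generic) auto
  then have "real n ^ n / fact n \<le> exp (real n)"
    by (simp add: exp_def divide_inverse mult.commute)
  then show ?thesis by (simp add: field_simps)
qed

section \<open>Union bound over words\<close>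

text \<open>There are \<open>card B ^ L\<close> words of length exactly \<open>L\<close>, and each
  contains all members of at most \<open>(t ^ card A) ^ card I\<close> families. By
  \<open>less\<close>, these cannot exhaust all \<open>fact (card A) ^ card I\<close>
  families.\<close>

lemma ex_uncontained_family:
  fixes t :: real and L :: nat and A :: "'a set"
  assumes "finite I" "finite A" "finite B" "B \<noteq> {}" "t > 0"
    and L: "real L \<le> t * real (card A)"
    and less: "real (card B) ^ L * (t ^ card A) ^ card I < fact (card A) ^ card I"
  shows "\<exists>P \<in> I \<rightarrow> permutations_of_set A.
    \<forall>w. set w \<subseteq> B \<longrightarrow> length w \<le> L \<longrightarrow> (\<exists>i\<in>I. \<not> subseq (P i) w)"
proof (rule ccontr)
  assume contr: "\<not> ?thesis"
  define W where "W = {w. set w \<subseteq> B \<and> length w = L}"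
  have finW: "finite W" and cardW: "card W = card B ^ L"
    using assms(3) by (simp_all add: W_def finite_lists_length_eq card_lists_length_eq)
  have "(I \<rightarrow>\<^sub>E permutations_of_set A) \<subseteq> (\<Union>w\<in>W. I \<rightarrow>\<^sub>E contained_perms A w)"
  proof
    fix P assume P: "P \<in> I \<rightarrow>\<^sub>E permutations_of_set A"
    then have "P \<in> I \<rightarrow> permutations_of_set A" by auto
    with contr obtain w where w: "set w \<subseteq> B" "length w \<le> L" "\<forall>i\<in>I. subseq (P i) w"
      by blast
    from assms(4) obtain b where "b \<in> B" by blast
    \<comment> \<open>Padding to length exactly \<open>L\<close> keeps every subsequence, so shorter
      words need no separate count.\<close>
    define w' where "w' = w @ replicate (L - length w) b"
    have "w' \<in> W" using w \<open>b \<in> B\<close> by (auto simp: W_def w'_def)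
    moreover have "P \<in> I \<rightarrow>\<^sub>E contained_perms A w'"
      using P w(3) by (auto simp: contained_perms_def w'_def PiE_iff)
    ultimately show "P \<in> (\<Union>w\<in>W. I \<rightarrow>\<^sub>E contained_perms A w)" by blast
  qed
  then have "card (I \<rightarrow>\<^sub>E permutations_of_set A) \<le> card (\<Union>w\<in>W. I \<rightarrow>\<^sub>E contained_perms A w)"
    using assms(1) finW by (intro card_mono finite_UN_I finite_PiE) auto
  also have "\<dots> \<le> (\<Sum>w\<in>W. card (I \<rightarrow>\<^sub>E contained_perms A w))"
    by (rule card_UN_le[OF finW])
  finally have "real (card (I \<rightarrow>\<^sub>E permutations_of_set A))
      \<le> (\<Sum>w\<in>W. real (card (I \<rightarrow>\<^sub>E contained_perms A w)))"
    by (simp flip: of_nat_sum)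
  also have "\<dots> \<le> (\<Sum>w\<in>W. (t ^ card A) ^ card I)"
  proof (intro sum_mono)
    fix w assume "w \<in> W"
    then have "real (card (contained_perms A w)) \<le> t ^ card A"
      using assms L by (intro card_contained_perms_le_power) (auto simp: W_def)
    then show "real (card (I \<rightarrow>\<^sub>E contained_perms A w)) \<le> (t ^ card A) ^ card I"
      using assms(1) by (simp add: card_PiE power_mono)
  qed
  finally have "fact (card A) ^ card I \<le> real (card B) ^ L * (t ^ card A) ^ card I"
    using assms(1,2) by (simp add: card_PiE cardW)
  with less show False by simp
qed

section \<open>The network and its fixing words\<close>

text \<open>The index into the family is the set of true coordinates in \<open>{N<..n}\<close>. If
  \<open>P\<close> takes its values in the permutations of \<open>{1..N}\<close>, those coordinates
  never change, so the index stays the same along every trajectory.\<close>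

definition unfolding_network ::
    "nat \<Rightarrow> nat \<Rightarrow> (nat set \<Rightarrow> nat list) \<Rightarrow> (nat \<Rightarrow> bool) \<Rightarrow> nat \<Rightarrow> bool" where
  "unfolding_network n N P x = (\<lambda>i\<in>{1..n}. x i \<or>
     (\<exists>k<N. P {j\<in>{N<..n}. x j} ! k = i \<and> (\<forall>l<k. x (P {j\<in>{N<..n}. x j} ! l))))"

lemma network_unfolding_network: "network n (unfolding_network n N P)"
  by (auto simp: network_def cube_def unfolding_network_def)

lemma increasing_unfolding_network: "increasing n (unfolding_network n N P)"
  by (auto simp: increasing_def unfolding_network_def)

text \<open>Start with exactly the coordinates in \<open>S\<close> true. At each moment a single
  coordinate can rise, the next entry of \<open>P S\<close>, so the letters of \<open>w\<close> that
  change the state spell out \<open>P S\<close> in order.\<close>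

lemma subseq_if_fixing_word:
  assumes "N \<le> n" and P: "P \<in> Pow {N<..n} \<rightarrow> permutations_of_set {1..N}"
    and fw: "fixing_word n (unfolding_network n N P) w" and S: "S \<subseteq> {N<..n}"
  shows "subseq (P S) w"
proof -
  define f where "f = unfolding_network n N P"
  define p where "p = P S"
  have p: "distinct p" "set p = {1..N}"
    using P S by (auto simp: p_def permutations_of_set_def Pi_iff)
  have len: "length p = N" using distinct_card[OF p(1)] p(2) by simp
  define st where "st k = (\<lambda>i\<in>{1..n}. i \<in> S \<or> i \<in> set (take k p))" for k
  have sel: "P {j\<in>{N<..n}. st k j} = p" for k
  proof -
    have "set (take k p) \<subseteq> {1..N}" using set_take_subset[of k p] p(2) by simp
    then have "{j\<in>{N<..n}. st k j} = S" using S by (auto simp: st_def)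
    then show ?thesis by (simp add: p_def)
  qed
  have nthN: "p ! l \<in> {1..N}" if "l < N" for l using that len p(2) nth_mem by metis
  have st_nth: "st k (p ! l) \<longleftrightarrow> l < k" if "l < N" for k l
  proof -
    have "p ! l \<notin> S" "p ! l \<in> {1..n}" using nthN[OF that] S \<open>N \<le> n\<close> by auto
    moreover have "p ! l \<in> set (take k p) \<longleftrightarrow> l < k"
      using that p(1) len by (auto simp: in_set_conv_nth nth_eq_iff_index_eq)
    ultimately show ?thesis by (simp add: st_def)
  qed
  \<comment> \<open>Entries with \<open>l < k\<close> are already true in \<open>st k\<close>, so
    only \<open>p ! k\<close> can be newly raised.\<close>
  have f_st: "f (st k) i \<longleftrightarrow> st k i \<or> (\<exists>l<N. p ! l = i \<and> l \<le> k)" if "i \<in> {1..n}" for i k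
  proof -
    have "(\<forall>l'<l. st k (p ! l')) \<longleftrightarrow> l \<le> k" if "l < N" for l
      using that st_nth by (metis less_le_trans linorder_not_less order_less_trans order.strict_iff_order)
    moreover have "f (st k) i \<longleftrightarrow> st k i \<or> (\<exists>l<N. p ! l = i \<and> (\<forall>l'<l. st k (p ! l')))"
      using that by (simp only: f_def unfolding_network_def sel restrict_apply if_True)
    ultimately show ?thesis by metis
  qed
  \<comment> \<open>Invariant for prefixes of the word: the state reached is some
    \<open>st k\<close>, and the letters read so far contain the first \<open>k\<close> entries of
    \<open>p\<close>.\<close>
  have "\<exists>k\<le>N. update_word f v (st 0) = st k \<and> subseq (take k p) v" if "set v \<subseteq> {1..n}" for v
    using that
  proof (induction v rule: rev_induct)
    case Nil
    show ?case by (intro exI[of _ 0]) (simp add: update_word_def)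
  next
    case (snoc a v)
    then obtain k where k: "k \<le> N" "update_word f v (st 0) = st k" "subseq (take k p) v"
      by auto
    have a: "a \<in> {1..n}" using snoc.prems by auto
    have upd: "update_word f (v @ [a]) (st 0) = (st k)(a := f (st k) a)"
      by (simp add: update_word_append k(2)) (simp add: update_word_def update_def)
    show ?case
    proof (cases "f (st k) a = st k a")
      case True
      then have "update_word f (v @ [a]) (st 0) = st k" by (simp add: upd)
      then show ?thesis using k(1) subseq_rev_drop_many[OF k(3)] by blast
    next
      case False
      then have nst: "\<not> st k a" and fa: "f (st k) a" using f_st[OF a, of k] by auto
      then obtain l where l: "l < N" "p ! l = a" "l \<le> k" using f_st[OF a, of k] by auto
      with nst st_nth have "l = k" by auto
      with l have tk: "take (Suc k) p = take k p @ [a]"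
        using len by (simp add: take_Suc_conv_app_nth)
      have "(st k)(a := f (st k) a) = st (Suc k)"
        using a fa by (auto simp: st_def tk fun_eq_iff)
      moreover have "subseq (take (Suc k) p) (v @ [a])"
        unfolding tk using k(3) by (intro list_emb_append_mono) auto
      ultimately show ?thesis using l \<open>l = k\<close> upd by (intro exI[of _ "Suc k"]) simp
    qed
  qed
  then obtain k where k: "k \<le> N" "update_word f w (st 0) = st k" "subseq (take k p) w"
    using fw unfolding fixing_word_def by blast
  have "st 0 \<in> cube n" by (simp add: st_def cube_def)
  with fw k(2) have fixed: "f (st k) = st k" by (auto simp: fixing_word_def f_def)
  \<comment> \<open>For \<open>k < N\<close> the entry \<open>p ! k\<close> could still rise, so
    \<open>st k\<close> would not be a fixed point.\<close>
  have "k = N"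
  proof (rule ccontr)
    assume "k \<noteq> N"
    with k(1) have "k < N" by simp
    moreover from this nthN[of k] \<open>N \<le> n\<close> have "p ! k \<in> {1..n}" by auto
    ultimately have "f (st k) (p ! k)" "\<not> st k (p ! k)" using f_st st_nth by auto
    with fixed show False by simp
  qed
  with k(3) len show ?thesis by (simp add: p_def)
qed

lemma fixing_length_word:
  assumes "network n f" "increasing n f"
  obtains w where "fixing_word n f w" "length w = fixing_length n f"
proof -
  have "\<exists>k w. fixing_word n f w \<and> length w = k"
    using increasing_fixing_word_exists[OF assms] by blast
  from LeastI_ex[OF this] show ?thesis using that unfolding fixing_length_def by blast
qed

section \<open>Choice of parameters and asymptotics\<close>

text \<open>Assumption \<open>N\<close> makes the permutations contained in one word at most a
  fraction \<open>q ^ N\<close> of all. Assumption \<open>M\<close> makes this fraction, raised to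
  the size of the family, outweigh the number of words.\<close>

lemma ex_network_fixing_length_ge:
  fixes c q :: real
  assumes c: "0 < c" and q: "0 < q" "q < 1" and "N < n"
    and N: "c * exp 1 * (real n)\<^sup>2 \<le> q * (real N)\<^sup>2"
    and M: "c * (real n)\<^sup>2 * ln (real n) < real N * 2 ^ (n - N) * ln (1 / q)"
  shows "\<exists>f. network n f \<and> increasing n f \<and> real (fixing_length n f) \<ge> c * (real n)\<^sup>2"
proof -
  have "n > 0" using \<open>N < n\<close> by simp
  have "N > 0"
  proof (rule ccontr)
    assume "\<not> N > 0"
    with N c \<open>n > 0\<close> show False by (simp add: mult_le_0_iff)
  qed
  \<comment> \<open>\<open>t\<close> bounds the average number of occurrences per letter of
    \<open>{1..N}\<close>, since \<open>L \<le> c * n^2 = t * N\<close>. \<open>M\<close> is the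
    number of subsets of \<open>{N<..n}\<close>, hence the size of the family.\<close>
  define t where "t = c * (real n)\<^sup>2 / real N"
  define L where "L = nat \<lfloor>c * (real n)\<^sup>2\<rfloor>"
  define M where "M = (2::nat) ^ (n - N)"
  have t: "t > 0" using c \<open>n > 0\<close> \<open>N > 0\<close> by (simp add: t_def)
  have L: "real L \<le> c * (real n)\<^sup>2" using c by (simp add: L_def)
  have "t * exp 1 \<le> q * real N"
    using N \<open>N > 0\<close> by (simp add: t_def field_simps power2_eq_square)
  then have "(t * exp 1) ^ N \<le> (q * real N) ^ N" using t by (intro power_mono) auto
  also have "\<dots> = q ^ N * real N ^ N" by (simp add: power_mult_distrib)
  also have "\<dots> \<le> q ^ N * (exp (real N) * fact N)"
    using q by (intro mult_left_mono power_le_exp_mult_fact) auto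
  finally have tN: "t ^ N \<le> q ^ N * fact N"
    by (simp add: power_mult_distrib flip: exp_of_nat_mult)
  have "real n ^ L * q ^ (N * M) < 1"
  proof -
    have "real L * ln (real n) \<le> c * (real n)\<^sup>2 * ln (real n)"
      using L \<open>n > 0\<close> by (intro mult_right_mono) auto
    also have "\<dots> < real (N * M) * ln (1 / q)" using assms(6) by (simp add: M_def)
    finally have "ln (real n ^ L * q ^ (N * M)) < 0"
      using q \<open>n > 0\<close> by (simp add: ln_mult ln_realpow ln_div)
    then show ?thesis using q \<open>n > 0\<close> by simp
  qed
  then have "real n ^ L * q ^ (N * M) * fact N ^ M < 1 * fact N ^ M"
    by (rule mult_strict_right_mono) simp
  moreover have "real n ^ L * (t ^ N) ^ M \<le> real n ^ L * (q ^ N * fact N) ^ M"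
    using tN t by (intro mult_left_mono power_mono) auto
  ultimately have less: "real n ^ L * (t ^ N) ^ M < fact N ^ M"
    unfolding power_mult_distrib power_mult mult.assoc mult_1 by (rule le_less_trans[rotated])
  obtain P where P: "P \<in> Pow {N<..n} \<rightarrow> permutations_of_set {1..N}"
    and P': "\<forall>w. set w \<subseteq> {1..n} \<longrightarrow> length w \<le> L \<longrightarrow> (\<exists>S\<in>Pow {N<..n}. \<not> subseq (P S) w)"
    using ex_uncontained_family[of "Pow {N<..n}" "{1..N}" "{1..n}" t L] t L less \<open>n > 0\<close> \<open>N > 0\<close>
    by (auto simp: card_Pow M_def t_def)
  let ?f = "unfolding_network n N P"
  obtain w where w: "fixing_word n ?f w" "length w = fixing_length n ?f"
    using fixing_length_word[OF network_unfolding_network increasing_unfolding_network] .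
  have "subseq (P S) w" if "S \<in> Pow {N<..n}" for S
    using subseq_if_fixing_word[OF _ P w(1)] that \<open>N < n\<close> by auto
  with P' w(1) have "\<not> length w \<le> L" by (auto simp: fixing_word_def)
  \<comment> \<open>\<open>L\<close> is a floor, so an integer exceeding \<open>L\<close> also
    exceeds \<open>c * n^2\<close>.\<close>
  then have "real (length w) \<ge> c * (real n)\<^sup>2" unfolding L_def by linarith
  then show ?thesis using w(2) network_unfolding_network increasing_unfolding_network by metis
qed

theorem theorem7:
  shows "\<forall>\<epsilon>::real. \<epsilon> > 0 \<longrightarrow>
    (\<exists>n0::nat. \<forall>n\<ge>n0. \<exists>f. network n f \<and> increasing n f \<and>
       real (fixing_length n f) \<ge> (1 / exp 1 - \<epsilon>) * (real n)\<^sup>2)"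
proof (intro allI impI)
  fix \<epsilon> :: real assume "\<epsilon> > 0"
  \<comment> \<open>The maximum keeps \<open>c\<close> positive for large \<open>\<epsilon>\<close>;
    both candidates are below \<open>1 / e\<close>. \<open>q\<close> is the midpoint of
    \<open>c * e\<close> and 1: the gap above \<open>c * e\<close> absorbs the loss from
    \<open>n\<close> to \<open>N\<close>, the gap below 1 gives exponential decay.\<close>
  define c where "c = max (1 / exp 1 - \<epsilon>) (1 / (2 * exp 1))"
  define q where "q = (1 + c * exp 1) / 2"
  have c: "0 < c" "c * exp 1 < 1" and c_ge: "1 / exp 1 - \<epsilon> \<le> c"
    using \<open>\<epsilon> > 0\<close> by (auto simp: c_def max_def field_simps)
  have q: "0 < q" "q < 1" "c * exp 1 < q"
    using c mult_pos_pos[OF c(1), of "exp 1"] by (auto simp: q_def intro: add_pos_pos)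
  define \<delta> where "\<delta> = ln (1 / q)"
  have \<delta>: "\<delta> > 0" using q by (simp add: \<delta>_def)
  \<comment> \<open>A lower bound for the number \<open>N\<close> of unfrozen coordinates, the 1
    allowing for rounding up.\<close>
  define r where "r x = x - (2 * log 2 x + 1)" for x :: real
  have "eventually (\<lambda>n. c * exp 1 * (real n)\<^sup>2 \<le> q * (r (real n))\<^sup>2) at_top"
    using q(3) unfolding r_def by real_asymp
  \<comment> \<open>The right side grows like \<open>n^3\<close>, against \<open>n^2 * ln n\<close>
    on the left.\<close>
  moreover have "eventually (\<lambda>n. c * (real n)\<^sup>2 * ln (real n) < r (real n) * (real n)\<^sup>2 * \<delta>) at_top"
    using \<delta> c(1) unfolding r_def by real_asymp
  moreover have "eventually (\<lambda>n. r (real n) > 0) at_top"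
    unfolding r_def by real_asymp
  ultimately have "eventually (\<lambda>n. \<exists>f. network n f \<and> increasing n f \<and>
      real (fixing_length n f) \<ge> c * (real n)\<^sup>2) at_top"
    using eventually_gt_at_top[of 1]
  proof eventually_elim
    case (elim n)
    \<comment> \<open>The least number of frozen coordinates with
      \<open>2 ^ m \<ge> n^2\<close>.\<close>
    define m where "m = nat \<lceil>2 * log 2 (real n)\<rceil>"
    have log: "log 2 (real n) > 0" using elim(4) by simp
    then have m: "2 * log 2 (real n) \<le> real m" "real m < 2 * log 2 (real n) + 1" "m > 0"
      unfolding m_def by linarith+
    have "2 * log 2 (real n) = log 2 ((real n)\<^sup>2)"
      using elim(4) by (simp add: log_nat_power)
    then have "(real n)\<^sup>2 = 2 powr (2 * log 2 (real n))"
      using elim(4) by (simp only:) simp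
    also have "\<dots> \<le> 2 powr real m" using m(1) by simp
    finally have two: "(real n)\<^sup>2 \<le> 2 ^ m" by (simp add: powr_realpow)
    have "m < n" using m(2) elim(3) unfolding r_def by simp
    define N where "N = n - m"
    have N: "N < n" "n - N = m" "r (real n) \<le> real N"
      using \<open>m < n\<close> m by (auto simp: N_def r_def)
    note elim(1)
    also have "q * (r (real n))\<^sup>2 \<le> q * (real N)\<^sup>2"
      using q N(3) elim(3) by (intro mult_left_mono power_mono) auto
    finally have bound_N: "c * exp 1 * (real n)\<^sup>2 \<le> q * (real N)\<^sup>2" .
    note elim(2)
    also have "r (real n) * (real n)\<^sup>2 * \<delta> \<le> real N * 2 ^ m * \<delta>"
      using N(3) two \<delta> elim(3) by (intro mult_right_mono mult_mono) auto
    finally have "c * (real n)\<^sup>2 * ln (real n) < real N * 2 ^ (n - N) * ln (1 / q)"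
      by (simp only: N(2) \<delta>_def)
    with c(1) q(1,2) N(1) bound_N show ?case by (rule ex_network_fixing_length_ge)
  qed
  then obtain n0 where n0: "\<forall>n\<ge>n0. \<exists>f. network n f \<and> increasing n f \<and>
      real (fixing_length n f) \<ge> c * (real n)\<^sup>2"
    by (auto simp: eventually_at_top_linorder)
  have "(1 / exp 1 - \<epsilon>) * (real n)\<^sup>2 \<le> c * (real n)\<^sup>2" for n
    using c_ge by (intro mult_right_mono) auto
  with n0 show "\<exists>n0. \<forall>n\<ge>n0. \<exists>f. network n f \<and> increasing n f \<and>
      real (fixing_length n f) \<ge> (1 / exp 1 - \<epsilon>) * (real n)\<^sup>2"
    by (meson order_trans)
qed

end
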